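(* For any integer $\gamma \geq 0$, the partial composition of $\mathsf{Dias}_\gamma$ over the $\mathsf{K}$-basis satisfies, for all words $x$ and $y$ of $\mathsf{Dias}_\gamma$ of arities at least $2$ and every position $i$ of $x$, $$\mathsf{K}^{(\gamma)}_x \circ_i \mathsf{K}^{(\gamma)}_y = \begin{cases} \mathsf{K}^{(\gamma)}_{x \circ_i y} & \text{if } \min(y) > x_i, \\ \sum_{a \in \{x_i, x_i+1, \dots, \gamma\}} \mathsf{K}^{(\gamma)}_{x \circ_{a,i} y} & \text{if } \min(y) = x_i, \\ 0 & \text{otherwise } (\min(y) < x_i). \end{cases}$$
   Context: The ground field has characteristic zero; $[\gamma]=\{1,\dots,\gamma\}$. $\mathsf{Dias}_\gamma$ is the nonsymmetric operad in vector spaces whose arity-$n$ component ($n \geq 1$) has as basis the words of length $n$ on $\{0\} \cup [\gamma]$ with exactly one occurrence of $0$, with partial compositions given linearly by $u \circ_i v := u_1 \dots u_{i-1}\,\max(u_i, v_1) \dots \max(u_i, v_m)\, u_{i+1} \dots u_n$. (It is the suboperad generated by the words $0a, a0$, $a \in [\gamma]$, of the operad of all words on $\{0\}\cup[\gamma]$ with these compositions.) On words of $\mathsf{Dias}_\gamma$ of the same arity $n$, set $x \preccurlyeq_\gamma y$ if $x_i \leq y_i$ for all $i \in \{1,\dots,n\}$, and let $\mu_\gamma$ be the Möbius function of this poset. The $\mathsf{K}$-basis of $\mathsf{Dias}_\gamma$ is the family $\mathsf{K}^{(\gamma)}_x := \sum_{x \preccurlyeq_\gamma x'} \mu_\gamma(x,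 x')\, x'$, for $x$ a word of $\mathsf{Dias}_\gamma$. For a word $y$ of $\mathsf{Dias}_\gamma$ of length at least $2$, $\min(y)$ is the smallest letter of $y$ among its letters different from $0$. For words $x, y$ of $\mathsf{Dias}_\gamma$, a position $i$ with $x_i \neq 0$, and $a \in [\gamma]$, $x \circ_{a,i} y$ denotes the word $x \circ_i y$ in which the letter at the position coming from the $0$ of $y$ (which equals $x_i$ in $x \circ_i y$) is replaced by $a$. *)

theory Defs
  imports "HOL-Library.Poly_Mapping"
begin

definition dias_words :: "nat \<Rightarrow> nat \<Rightarrow> nat list set" where
  "dias_words \<gamma> n = {w. length w = n \<and> set w \<subseteq> {0..\<gamma>} \<and> count_list w 0 = 1}"

text \<open>Positions in words are counted from \<open>1\<close>, so the letter of \<open>u\<close> at position \<open>i\<close>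
  is \<open>u ! (i - 1)\<close>.\<close>

definition word_comp :: "nat \<Rightarrow> nat list \<Rightarrow> nat list \<Rightarrow> nat list" where
  "word_comp i u v = take (i - 1) u @ map (max (u ! (i - 1))) v @ drop i u"

text \<open>The component of arity \<open>n\<close> of the operad is the space of finitely supported functions
  whose keys lie in \<open>dias_words \<gamma> n\<close>. The partial composition is the bilinear extension
  of \<^const>\<open>word_comp\<close>.\<close>

definition dias_comp ::
  "nat \<Rightarrow> (nat list \<Rightarrow>\<^sub>0 'k::field_char_0) \<Rightarrow> (nat list \<Rightarrow>\<^sub>0 'k) \<Rightarrow> (nat list \<Rightarrow>\<^sub>0 'k)" where
  "dias_comp i f g =
     (\<Sum>u\<in>Poly_Mapping.keys f. \<Sum>v\<in>Poly_Mapping.keys g.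
        Poly_Mapping.single (word_comp i u v) (Poly_Mapping.lookup f u * Poly_Mapping.lookup g v))"

lemma word_comp_in_dias_words:
  assumes u: "u \<in> dias_words \<gamma> n" and v: "v \<in> dias_words \<gamma> m" and i: "i \<in> {1..n}"
  shows "word_comp i u v \<in> dias_words \<gamma> (n + m - 1)"
proof -
  have len: "i - 1 < length u" "Suc (i - 1) = i"
    using u i by (auto simp: dias_words_def)
  have split: "u = take (i - 1) u @ u ! (i - 1) # drop i u"
    using id_take_nth_drop[OF len(1)] len(2) by simp
  have max0: "count_list (map (max a) v) 0 = (if a = 0 then count_list v 0 else 0)" for a
    by (cases a; induction v) auto
  have "count_list u 0
      = count_list (take (i - 1) u) 0 + (if u ! (i - 1) = 0 then 1 else 0) + count_list (drop i u) 0"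
    by (subst split) simp
  then have "count_list (word_comp i u v) 0 = 1"
    using u v by (auto simp: word_comp_def max0 dias_words_def split: if_splits)
  moreover have "length (word_comp i u v) = n + m - 1"
    using u v i by (auto simp: word_comp_def dias_words_def)
  moreover have "u ! (i - 1) \<le> \<gamma>"
    using u nth_mem[OF len(1)] by (auto simp: dias_words_def)
  then have "set (word_comp i u v) \<subseteq> {0..\<gamma>}"
    using u v by (auto simp: word_comp_def dias_words_def dest: in_set_takeD in_set_dropD)
  ultimately show ?thesis
    by (simp add: dias_words_def)
qed

definition dias_le :: "nat list \<Rightarrow> nat list \<Rightarrow> bool" where
  "dias_le x y \<longleftrightarrow> list_all2 (\<le>) x y"

lemma dias_le_sum_list_less:
  assumes "dias_le x y" "x \<noteq> y"
  shows "sum_list x < sum_list y"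
proof -
  have "sum_list x \<le> sum_list y \<and> (x \<noteq> y \<longrightarrow> sum_list x < sum_list y)"
    using assms(1) unfolding dias_le_def by (induction rule: list_all2_induct) auto
  then show ?thesis using assms(2) by simp
qed

function dias_mu :: "nat \<Rightarrow> nat list \<Rightarrow> nat list \<Rightarrow> int" where
  "dias_mu \<gamma> x z =
     (if x = z then 1
      else if dias_le x z then
        - (\<Sum>y \<in> {y \<in> dias_words \<gamma> (length x). dias_le x y \<and> dias_le y z \<and> y \<noteq> z}. dias_mu \<gamma> x y)
      else 0)"
  by auto
termination
  by (relation "measure (\<lambda>(\<gamma>, x, z). sum_list z)") (auto intro: dias_le_sum_list_less)

text \<open>The defining equation loops as a rewrite rule.\<close>
declare dias_mu.simps [simp del]

definition dias_K :: "nat \<Rightarrow> nat list \<Rightarrow> (nat list \<Rightarrow>\<^sub>0 'k::field_char_0)" where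
  "dias_K \<gamma> x =
     (\<Sum>x' \<in> {x' \<in> dias_words \<gamma> (length x). dias_le x x'}.
        Poly_Mapping.single x' (of_int (dias_mu \<gamma> x x')))"

definition dias_min :: "nat list \<Rightarrow> nat" where
  "dias_min y = Min (set y - {0})"

text \<open>In \<open>word_comp i x y\<close> the letters of \<open>y\<close> occupy the positions \<open>i, \<dots>, i + length y - 1\<close>.
  With indices counted from \<open>0\<close>, the one coming from the letter \<open>0\<close> of \<open>y\<close> has index \<open>i - 1\<close>
  plus the number of letters of \<open>y\<close> before its \<open>0\<close>.\<close>

definition word_comp_at :: "nat \<Rightarrow> nat \<Rightarrow> nat list \<Rightarrow> nat list \<Rightarrow> nat list" where
  "word_comp_at a i x y =
     (word_comp i x y)[i - 1 + length (takeWhile (\<lambda>b. b \<noteq> 0) y) := a]"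

end

theory Submission
  imports Defs
begin

text \<open>The \<open>K\<close>-basis element of a word is a pure tensor of one-letter elements: with \<open>E a\<close> the
  letter \<open>a\<close> if \<open>a \<le> \<gamma>\<close> and \<open>0\<close> otherwise, a letter \<open>a > 0\<close> contributes \<open>E a - E (a + 1)\<close>
  and the letter \<open>0\<close> contributes \<open>E 0\<close>. This holds because intervals of the poset are products of
  chains. Composing with \<open>E p\<close> at position \<open>i\<close> applies \<open>max p\<close> to each tensor factor of
  the second argument, which fixes \<open>E c - E (c + 1)\<close> if \<open>c \<ge> p\<close>, kills it if \<open>0 < c < p\<close>, and sends
  \<open>E 0\<close> to \<open>E p\<close>. Applied to \<open>E p - E (p + 1)\<close>, this leaves both terms, the first one, or none,
  and \<open>E p\<close> telescopes as the sum of \<open>E a - E (a + 1)\<close> over \<open>p \<le> a \<le> \<gamma>\<close>.\<close>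

section \<open>Bilinear extension of maps on basis elements\<close>

definition bilin :: "('a \<Rightarrow> 'b \<Rightarrow> 'c) \<Rightarrow> ('a \<Rightarrow>\<^sub>0 'k::comm_ring_1) \<Rightarrow> ('b \<Rightarrow>\<^sub>0 'k) \<Rightarrow> ('c \<Rightarrow>\<^sub>0 'k)" where
  "bilin h f g = (\<Sum>u\<in>Poly_Mapping.keys f. \<Sum>v\<in>Poly_Mapping.keys g.
     Poly_Mapping.single (h u v) (Poly_Mapping.lookup f u * Poly_Mapping.lookup g v))"

text \<open>Terms outside the keys vanish because a lookup is 0 there. Enlarging the index sets lets
  the sides of an additivity statement be summed over common sets.\<close>

lemma bilin_superset:
  assumes "finite A" "finite B" "Poly_Mapping.keys f \<subseteq> A" "Poly_Mapping.keys g \<subseteq> B"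
  shows "bilin h f g = (\<Sum>u\<in>A. \<Sum>v\<in>B.
     Poly_Mapping.single (h u v) (Poly_Mapping.lookup f u * Poly_Mapping.lookup g v))"
proof -
  have "(\<Sum>u\<in>A. \<Sum>v\<in>B.
      Poly_Mapping.single (h u v) (Poly_Mapping.lookup f u * Poly_Mapping.lookup g v)) =
    (\<Sum>u\<in>Poly_Mapping.keys f. \<Sum>v\<in>B.
      Poly_Mapping.single (h u v) (Poly_Mapping.lookup f u * Poly_Mapping.lookup g v))"
    using assms by (intro sum.mono_neutral_right) (auto simp: in_keys_iff)
  also have "\<dots> = bilin h f g"
    unfolding bilin_def
    using assms by (intro sum.cong refl sum.mono_neutral_right) (auto simp: in_keys_iff)
  finally show ?thesis by simp
qed

lemma bilin_add_left: "bilin h (f + f') g = bilin h f g + bilin h f' g"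
proof -
  let ?A = "Poly_Mapping.keys f \<union> Poly_Mapping.keys f'"
  have "Poly_Mapping.keys (f + f') \<subseteq> ?A" by (rule Poly_Mapping.keys_add)
  then show ?thesis
    by (simp add: bilin_superset[of ?A "Poly_Mapping.keys g"] lookup_add
        distrib_right single_add sum.distrib)
qed

lemma bilin_add_right: "bilin h f (g + g') = bilin h f g + bilin h f g'"
proof -
  let ?B = "Poly_Mapping.keys g \<union> Poly_Mapping.keys g'"
  have "Poly_Mapping.keys (g + g') \<subseteq> ?B" by (rule Poly_Mapping.keys_add)
  then show ?thesis
    by (simp add: bilin_superset[of "Poly_Mapping.keys f" ?B] lookup_add
        distrib_left single_add sum.distrib)
qed

lemma bilin_zero_left [simp]: "bilin h 0 g = 0"
  and bilin_zero_right [simp]: "bilin h f 0 = 0"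
  by (simp_all add: bilin_def)

lemma bilin_single [simp]:
  "bilin h (Poly_Mapping.single u a) (Poly_Mapping.single v b) = Poly_Mapping.single (h u v) (a * b)"
  by (subst bilin_superset[of "{u}" "{v}"]) auto

lemma bilin_diff_left: "bilin h (f - f') g = bilin h f g - bilin h f' g"
  using bilin_add_left[of h "f - f'" f' g] by (simp add: algebra_simps)

lemma bilin_diff_right: "bilin h f (g - g') = bilin h f g - bilin h f g'"
  using bilin_add_right[of h f "g - g'" g'] by (simp add: algebra_simps)

lemma bilin_sum_left: "bilin h (sum F A) g = (\<Sum>a\<in>A. bilin h (F a) g)"
  by (induction A rule: infinite_finite_induct) (simp_all add: bilin_add_left)

lemma bilin_sum_right: "bilin h f (sum F A) = (\<Sum>a\<in>A. bilin h f (F a))"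
  by (induction A rule: infinite_finite_induct) (simp_all add: bilin_add_right)

lemma poly_mapping_eq_sum_single:
  fixes f :: "'a \<Rightarrow>\<^sub>0 'b::comm_monoid_add"
  shows "f = (\<Sum>u\<in>Poly_Mapping.keys f. Poly_Mapping.single u (Poly_Mapping.lookup f u))"
  by (rule poly_mapping_eqI)
    (simp add: lookup_sum lookup_single when_def in_keys_iff)

text \<open>Serves to check identities between multilinear expressions on basis elements, one
  argument at a time.\<close>

lemma poly_mapping_single_induct [case_names zero single add]:
  fixes f :: "'a \<Rightarrow>\<^sub>0 'b::comm_monoid_add"
  assumes "P 0" "\<And>u a. P (Poly_Mapping.single u a)" "\<And>f g. P f \<Longrightarrow> P g \<Longrightarrow> P (f + g)"
  shows "P f"
proof -
  have "P (\<Sum>u\<in>A. Poly_Mapping.single u (Poly_Mapping.lookup f u))" for A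
    by (induction A rule: infinite_finite_induct) (use assms in auto)
  then show ?thesis by (subst poly_mapping_eq_sum_single)
qed

lemma bilin_trilinear_left:
  assumes "\<And>u v w. h1 (h2 u v) w = h3 u (h4 v w)"
  shows "bilin h1 (bilin h2 f g) k = bilin h3 f (bilin h4 g k)"
proof (induction f rule: poly_mapping_single_induct)
  case (single u a)
  show ?case
  proof (induction g rule: poly_mapping_single_induct)
    case (single v b)
    show ?case
      by (induction k rule: poly_mapping_single_induct)
        (simp_all add: assms bilin_add_right mult.assoc)
  qed (simp_all add: bilin_add_left bilin_add_right)
qed (simp_all add: bilin_add_left)

text \<open>The acting letter \<open>b\<close> is a fixed basis element: composition copies it onto
  every letter of the second word, which is not linear in that letter. With coefficient 1 the copies
  introduce no scalar.\<close>

lemma bilin_letterwise: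
  assumes "\<And>u v w. h1 u (h2 v w) = h3 (h4 b v) (h1 u w)"
  shows "bilin h1 f (bilin h2 g k) =
    bilin h3 (bilin h4 (Poly_Mapping.single b 1) g) (bilin h1 f k)"
proof (induction f rule: poly_mapping_single_induct)
  case (single u a)
  show ?case
  proof (induction g rule: poly_mapping_single_induct)
    case (single v b)
    show ?case
      by (induction k rule: poly_mapping_single_induct)
        (simp_all add: assms bilin_add_right mult.left_commute)
  qed (simp_all add: bilin_add_left bilin_add_right)
qed (simp_all add: bilin_add_left bilin_add_right)

lemma dias_comp_eq_bilin: "dias_comp i = bilin (word_comp i)"
  by (simp add: fun_eq_iff dias_comp_def bilin_def)

section \<open>Pure tensors and their composition\<close>

fun tens :: "('a \<Rightarrow>\<^sub>0 'k::comm_ring_1) list \<Rightarrow> ('a list \<Rightarrow>\<^sub>0 'k)" where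
  "tens [] = Poly_Mapping.single [] 1"
| "tens (f # fs) = bilin (#) f (tens fs)"

lemma tens_add: "tens (fs @ (f + g) # hs) = tens (fs @ f # hs) + tens (fs @ g # hs)"
  by (induction fs) (simp_all add: bilin_add_left bilin_add_right)

lemma tens_eq_0: "0 \<in> set fs \<Longrightarrow> tens fs = 0"
  by (induction fs) auto

lemma tens_diff: "tens (fs @ (f - g) # hs) = tens (fs @ f # hs) - tens (fs @ g # hs)"
  using tens_add[of fs "f - g" g hs] by (simp add: algebra_simps)

lemma tens_sum: "tens (fs @ sum F A # hs) = (\<Sum>a\<in>A. tens (fs @ F a # hs))"
  by (induction A rule: infinite_finite_induct) (simp_all add: tens_add tens_eq_0)

text \<open>The second word is transformed letter by letter, so a pure tensor stays pure. Induction
  on \<open>fs\<close> brings the position down to 1.\<close>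

lemma dias_comp_tens_single:
  "dias_comp (Suc (length fs)) (tens (fs @ Poly_Mapping.single b 1 # hs)) (tens gs) =
   tens (fs @ map (bilin max (Poly_Mapping.single b 1)) gs @ hs)"
proof (induction fs)
  case Nil
  \<comment> \<open>At position 1 the leading letter \<open>b\<close> is consumed and its tail
    \<open>u\<close> follows the transformed second word.\<close>
  let ?app = "\<lambda>u v. map (max b) v @ u"
  have "bilin (word_comp 1) (bilin (#) (Poly_Mapping.single b 1) f) g = bilin ?app f g"
    for f g :: "nat list \<Rightarrow>\<^sub>0 'a"
  proof (induction f rule: poly_mapping_single_induct)
    case (single u a)
    show ?case
      by (induction g rule: poly_mapping_single_induct)
        (simp_all add: bilin_add_right word_comp_def)
  qed (simp_all add: bilin_add_left bilin_add_right)
  moreover have "bilin ?app (tens hs) (tens gs) =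
    tens (map (bilin max (Poly_Mapping.single b 1)) gs @ hs)"
  proof (induction gs)
    case Nil
    have "bilin ?app f (Poly_Mapping.single [] 1) = f" for f :: "nat list \<Rightarrow>\<^sub>0 'a"
      by (induction f rule: poly_mapping_single_induct) (simp_all add: bilin_add_left)
    then show ?case by simp
  next
    case (Cons g gs)
    have "bilin ?app (tens hs) (bilin (#) g (tens gs)) =
      bilin (#) (bilin max (Poly_Mapping.single b 1) g) (bilin ?app (tens hs) (tens gs))"
      by (rule bilin_letterwise) simp
    with Cons show ?case by simp
  qed
  ultimately show ?case by (simp add: dias_comp_eq_bilin)
next
  case (Cons f fs)
  \<comment> \<open>Composition at a later position leaves the first letter alone, so the first
    tensor factor moves outside.\<close>
  have "bilin (word_comp (Suc (Suc (length fs)))) (bilin (#) f F) G =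
    bilin (#) f (bilin (word_comp (Suc (length fs))) F G)" for F G :: "nat list \<Rightarrow>\<^sub>0 'a"
    by (rule bilin_trilinear_left) (simp add: word_comp_def)
  with Cons show ?case by (simp add: dias_comp_eq_bilin)
qed

section \<open>One-letter elements and the action of \<open>max\<close>\<close>

definition letter :: "nat \<Rightarrow> nat \<Rightarrow> (nat \<Rightarrow>\<^sub>0 'k::field_char_0)" where
  "letter \<gamma> a = (if a \<le> \<gamma> then Poly_Mapping.single a 1 else 0)"

definition K_letter :: "nat \<Rightarrow> nat \<Rightarrow> (nat \<Rightarrow>\<^sub>0 'k::field_char_0)" where
  "K_letter \<gamma> a = (if a = 0 then letter \<gamma> 0 else letter \<gamma> a - letter \<gamma> (Suc a))"

text \<open>For \<open>p\<close> beyond \<gamma> both sides vanish, the right one because the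
  nonempty \<open>gs\<close> supplies a zero factor.\<close>

lemma dias_comp_tens_letter:
  assumes "gs \<noteq> []"
  shows "dias_comp (Suc (length fs)) (tens (fs @ letter \<gamma> p # hs)) (tens gs) =
    tens (fs @ map (bilin max (letter \<gamma> p)) gs @ hs)"
proof (cases "p \<le> \<gamma>")
  case True
  then show ?thesis by (simp add: letter_def dias_comp_tens_single)
next
  case False
  then have "tens (fs @ letter \<gamma> p # hs) = 0"
    and "tens (fs @ map (bilin max (letter \<gamma> p)) gs @ hs) = 0"
    using assms by (auto intro!: tens_eq_0 simp: letter_def image_iff ex_in_conv)
  then show ?thesis by (simp add: dias_comp_eq_bilin)
qed

lemma bilin_max_letter: "bilin max (letter \<gamma> p) (letter \<gamma> c) = letter \<gamma> (max p c)"
  by (simp add: letter_def)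

text \<open>For \<open>0 < c < p\<close> both \<open>c\<close> and \<open>Suc c\<close> are raised
  to \<open>p\<close>, so the two terms cancel; the single term of \<open>c = 0\<close> has no
  partner.\<close>

lemma bilin_max_K_letter:
  "bilin max (letter \<gamma> p) (K_letter \<gamma> c) =
   (if c = 0 then letter \<gamma> p else if p \<le> c then K_letter \<gamma> c else 0)"
proof (cases "p \<le> c")
  case True
  then show ?thesis by (auto simp: K_letter_def bilin_diff_right bilin_max_letter max_def)
next
  case False
  then show ?thesis by (simp add: K_letter_def bilin_diff_right bilin_max_letter max_absorb1)
qed

lemma letter_eq_sum_K_letter:
  assumes "0 < p" "p \<le> \<gamma>"
  shows "(letter \<gamma> p :: nat \<Rightarrow>\<^sub>0 'k::field_char_0) = (\<Sum>a\<in>{p..\<gamma>}. K_letter \<gamma> a)"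
proof -
  have "(\<Sum>a\<in>{p..\<gamma>}. K_letter \<gamma> a :: nat \<Rightarrow>\<^sub>0 'k) = (\<Sum>a\<in>{p..\<gamma>}. letter \<gamma> a - letter \<gamma> (Suc a))"
    using assms by (intro sum.cong) (auto simp: K_letter_def)
  also have "\<dots> = letter \<gamma> p - letter \<gamma> (Suc \<gamma>)"
    using assms sum_Suc_diff[of p \<gamma> "\<lambda>a. - letter \<gamma> a :: nat \<Rightarrow>\<^sub>0 'k"] by simp
  \<comment> \<open>The boundary term at \<open>Suc \<gamma>\<close> vanishes by the cutoff in
    \<open>letter\<close>.\<close>
  finally show ?thesis by (simp add: letter_def)
qed

section \<open>Moebius function of the word poset\<close>

definition chain_mu :: "nat \<Rightarrow> nat \<Rightarrow> int" where
  "chain_mu a b = (if b = a then 1 else if b = Suc a then - 1 else 0)"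

text \<open>With \<open>f\<close> returning its second argument this is the Moebius sum over an
  interval of a chain; with \<open>f\<close> building a \<open>single\<close> it expands
  \<open>K_letter\<close>.\<close>

lemma sum_chain_mu:
  fixes f :: "nat \<Rightarrow> int \<Rightarrow> 'b::comm_monoid_add"
  assumes "\<And>b. f b 0 = 0" "a \<le> c"
  shows "(\<Sum>b\<in>{a..c}. f b (chain_mu a b)) = f a 1 + (if a < c then f (Suc a) (-1) else 0)"
proof -
  have "(\<Sum>b\<in>{a..c}. f b (chain_mu a b)) = (\<Sum>b\<in>{b\<in>{a, Suc a}. b \<le> c}. f b (chain_mu a b))"
    using assms by (intro sum.mono_neutral_right) (auto simp: chain_mu_def)
  also have "{b\<in>{a, Suc a}. b \<le> c} = (if a < c then {a, Suc a} else {a})"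
    using assms by auto
  finally show ?thesis by (simp add: chain_mu_def)
qed

definition word_mu :: "nat list \<Rightarrow> nat list \<Rightarrow> int" where
  "word_mu x z = prod_list (map2 chain_mu x z)"

lemma set_Cons_eq_image: "set_Cons A W = (\<lambda>(b, w). b # w) ` (A \<times> W)"
  by (auto simp: set_Cons_def)

lemma finite_listset: "(\<And>A. A \<in> set As \<Longrightarrow> finite A) \<Longrightarrow> finite (listset As)"
  by (induction As) (simp_all add: set_Cons_eq_image)

lemma sum_listset_Cons: "(\<Sum>w\<in>listset (A # As). f w) = (\<Sum>b\<in>A. \<Sum>w\<in>listset As. f (b # w))"
proof -
  have "(\<Sum>w\<in>listset (A # As). f w) = (\<Sum>(b, w)\<in>A \<times> listset As. f (b # w))"
    by (simp add: set_Cons_eq_image sum.reindex inj_on_def case_prod_unfold)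
  then show ?thesis by (simp add: sum.cartesian_product)
qed

text \<open>The sum over a product of intervals factors over the letters; a factor is 1 for a
  one-point chain and 1 - 1 = 0 otherwise.\<close>

lemma sum_word_mu_interval:
  assumes "dias_le x z"
  shows "(\<Sum>y\<in>listset (map2 (\<lambda>a c. {a..c}) x z). word_mu x y) = (if x = z then 1 else 0)"
  using assms unfolding dias_le_def
proof (induction rule: list_all2_induct)
  case Nil
  then show ?case by (simp add: word_mu_def)
next
  case (Cons a x c z)
  have "(\<Sum>b\<in>{a..c}. chain_mu a b) = (if a = c then 1 else 0)"
    using sum_chain_mu[of "\<lambda>_ m. m" a c] Cons by auto
  moreover have "(\<Sum>y\<in>listset (map2 (\<lambda>a c. {a..c}) (a # x) (c # z)). word_mu (a # x) y) =
    (\<Sum>b\<in>{a..c}. chain_mu a b) * (\<Sum>y\<in>listset (map2 (\<lambda>a c. {a..c}) x z). word_mu x y)"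
    by (simp only: zip_Cons_Cons list.map case_prod_conv sum_listset_Cons)
      (simp add: word_mu_def flip: sum_product)
  ultimately show ?case using Cons by simp
qed

text \<open>The one-zero condition holds throughout the product of chains: the number of zeros can
  only drop going up, and it is 1 at both ends.\<close>

lemma dias_interval_eq_listset:
  assumes "x \<in> dias_words \<gamma> n" "z \<in> dias_words \<gamma> n" "dias_le x z"
  shows "{y \<in> dias_words \<gamma> (length x). dias_le x y \<and> dias_le y z} =
    listset (map2 (\<lambda>a c. {a..c}) x z)"
proof -
  have box: "listset (map2 (\<lambda>a c. {a..c}) x z) = {y. dias_le x y \<and> dias_le y z}"
    using assms(3) unfolding dias_le_def
    by (induction rule: list_all2_induct) (auto simp: set_Cons_def list_all2_Cons1)
  have count_antimono: "count_list v 0 \<le> count_list u 0" if "dias_le u v" for u v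
    using that unfolding dias_le_def by (induction rule: list_all2_induct) auto
  have "set y \<subseteq> {0..\<gamma>}" if "dias_le y z" for y
    using that assms(2)
    by (fastforce simp: dias_le_def dias_words_def list_all2_conv_all_nth in_set_conv_nth)
  moreover have "count_list y 0 = 1" if "dias_le x y" "dias_le y z" for y
    using count_antimono[OF that(1)] count_antimono[OF that(2)] assms by (simp add: dias_words_def)
  ultimately show ?thesis
    unfolding box by (auto simp: dias_words_def dias_le_def dest: list_all2_lengthD)
qed

text \<open>Both functions are 1 on the diagonal and sum to 0 over every nontrivial interval
  starting at \<open>x\<close>. Induction on the letter sum of \<open>z\<close> turns this into
  equality.\<close>

lemma dias_mu_eq_word_mu:
  assumes "x \<in> dias_words \<gamma> n" "z \<in> dias_words \<gamma> n" "dias_le x z"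
  shows "dias_mu \<gamma> x z = word_mu x z"
  using assms
proof (induction "sum_list z" arbitrary: z rule: less_induct)
  case less
  have diag: "word_mu x x = 1"
    by (induction x) (simp_all add: word_mu_def chain_mu_def)
  let ?I = "{y \<in> dias_words \<gamma> (length x). dias_le x y \<and> dias_le y z}"
  let ?J = "{y \<in> dias_words \<gamma> (length x). dias_le x y \<and> dias_le y z \<and> y \<noteq> z}"
  have len: "length x = n" using less.prems by (simp add: dias_words_def)
  show ?case
  proof (cases "x = z")
    case True
    then show ?thesis using diag by (subst dias_mu.simps) simp
  next
    case False
    have fin: "finite ?I"
      unfolding dias_interval_eq_listset[OF less.prems] by (rule finite_listset) auto
    have z: "z \<in> ?I"
      using less.prems len by (auto simp: dias_le_def list_all2_refl)
    have J: "?J = ?I - {z}" by auto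
    have "dias_mu \<gamma> x z = - (\<Sum>y\<in>?J. dias_mu \<gamma> x y)"
      using False less.prems by (subst dias_mu.simps) simp
    also have "(\<Sum>y\<in>?J. dias_mu \<gamma> x y) = (\<Sum>y\<in>?J. word_mu x y)"
      using less len by (intro sum.cong refl) (auto intro: dias_le_sum_list_less)
    also have "\<dots> = (\<Sum>y\<in>?I. word_mu x y) - word_mu x z"
      unfolding J using fin z by (subst sum_diff1) auto
    also have "(\<Sum>y\<in>?I. word_mu x y) = 0"
      unfolding dias_interval_eq_listset[OF less.prems]
      using sum_word_mu_interval[OF less.prems(3)] False by simp
    finally show ?thesis by simp
  qed
qed

section \<open>The K-basis as pure tensors\<close>

definition letters_above :: "nat \<Rightarrow> nat \<Rightarrow> nat set" where
  "letters_above \<gamma> a = (if a = 0 then {0} else {a..\<gamma>})"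

text \<open>Going up can only remove zeros, and one must remain, so the zero of \<open>x\<close>
  stays in place while the other letters vary independently.\<close>

lemma dias_up_set_eq_listset:
  assumes "x \<in> dias_words \<gamma> n"
  shows "{z \<in> dias_words \<gamma> (length x). dias_le x z} = listset (map (letters_above \<gamma>) x)"
proof -
  \<comment> \<open>The zero count of \<open>x\<close> replaces the value 1 because tails may
    contain no zero.\<close>
  have box: "listset (map (letters_above \<gamma>) x) =
      {z. dias_le x z \<and> set z \<subseteq> {0..\<gamma>} \<and> count_list z 0 = count_list x 0}"
    if "set x \<subseteq> {0..\<gamma>}"
    using that
  proof (induction x)
    case Nil
    then show ?case by (auto simp: dias_le_def)
  next
    case (Cons a x)
    have "count_list v 0 \<le> count_list x 0" if "list_all2 (\<le>) x v" for v
      using that by (induction rule: list_all2_induct) auto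
    \<comment> \<open>Raising a leading zero would require one more zero in the tail than
      \<open>x\<close> provides.\<close>
    then have "count_list v 0 \<noteq> Suc (count_list x 0)" if "list_all2 (\<le>) x v" for v
      using that by fastforce
    with Cons show ?case
      by (auto simp: set_Cons_def dias_le_def list_all2_Cons1 letters_above_def
          split: if_splits)
  qed
  show ?thesis
    using assms by (subst box) (auto simp: dias_words_def dias_le_def dest: list_all2_lengthD)
qed

lemma K_letter_eq_sum:
  assumes "a \<le> \<gamma>"
  shows "(K_letter \<gamma> a :: nat \<Rightarrow>\<^sub>0 'k::field_char_0) =
    (\<Sum>b\<in>letters_above \<gamma> a. Poly_Mapping.single b (of_int (chain_mu a b)))"
proof (cases "a = 0")
  case True
  then show ?thesis by (simp add: letters_above_def K_letter_def letter_def chain_mu_def)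
next
  case False
  then show ?thesis
    using sum_chain_mu[of "\<lambda>b m. Poly_Mapping.single b (of_int m :: 'k)" a \<gamma>] assms
    by (simp add: letters_above_def K_letter_def letter_def single_uminus Suc_le_eq)
qed

text \<open>The up-set is a product and the Moebius coefficients factor over the letters, so the
  defining sum is a multiplied-out tensor.\<close>

lemma dias_K_eq_tens:
  assumes "x \<in> dias_words \<gamma> n"
  shows "(dias_K \<gamma> x :: nat list \<Rightarrow>\<^sub>0 'k::field_char_0) = tens (map (K_letter \<gamma>) x)"
proof -
  have tens: "tens (map (K_letter \<gamma>) w) = (\<Sum>z\<in>listset (map (letters_above \<gamma>) w).
      Poly_Mapping.single z (of_int (word_mu w z) :: 'k))" if "set w \<subseteq> {0..\<gamma>}" for w
    using that
  proof (induction w)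
    case Nil
    then show ?case by (simp add: word_mu_def)
  next
    case (Cons a w)
    then show ?case
      by (simp only: list.map sum_listset_Cons tens.simps)
        (simp add: K_letter_eq_sum bilin_sum_left bilin_sum_right word_mu_def
          sum.swap[of _ "letters_above \<gamma> a"])
  qed
  have "dias_K \<gamma> x = (\<Sum>z\<in>{z \<in> dias_words \<gamma> (length x). dias_le x z}.
      Poly_Mapping.single z (of_int (word_mu x z) :: 'k))"
    unfolding dias_K_def
  proof (intro sum.cong refl)
    fix z assume "z \<in> {z \<in> dias_words \<gamma> (length x). dias_le x z}"
    moreover have "length x = n" using assms by (simp add: dias_words_def)
    ultimately show "Poly_Mapping.single z (of_int (dias_mu \<gamma> x z) :: 'k) =
        Poly_Mapping.single z (of_int (word_mu x z))"
      using dias_mu_eq_word_mu[OF assms] by simp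
  qed
  also have "\<dots> = tens (map (K_letter \<gamma>) x)"
    using assms by (subst dias_up_set_eq_listset[OF assms], subst tens) (auto simp: dias_words_def)
  finally show ?thesis .
qed

section \<open>Composition over the K-basis\<close>

theorem theorem2p3p7:
  fixes \<gamma> n m i :: nat and x y :: "nat list"
  assumes "x \<in> dias_words \<gamma> n" and "n \<ge> 2"
    and "y \<in> dias_words \<gamma> m" and "m \<ge> 2"
    and "i \<in> {1..n}"
  shows "dias_comp i (dias_K \<gamma> x) (dias_K \<gamma> y) =
    (if dias_min y > x ! (i - 1) then dias_K \<gamma> (word_comp i x y)
     else if dias_min y = x ! (i - 1) then
       (\<Sum>a\<in>{x ! (i - 1)..\<gamma>}. dias_K \<gamma> (word_comp_at a i x y))
     else (0 :: nat list \<Rightarrow>\<^sub>0 'k::field_char_0))"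
proof -
  define p where "p = x ! (i - 1)"
  define pre where "pre = take (i - 1) x"
  define post where "post = drop i x"
  have i: "i - 1 < length x" "Suc (i - 1) = i" "i = Suc (length pre)"
    using assms by (auto simp: dias_words_def pre_def)
  have x: "x = pre @ p # post"
    using id_take_nth_drop[OF i(1)] i(2) by (simp add: pre_def p_def post_def)
  have p_le: "p \<le> \<gamma>"
    using assms(1) by (simp add: x dias_words_def)
  have "0 \<in> set y"
    using assms(3) by (metis (mono_tags, lifting) count_notin dias_words_def mem_Collect_eq zero_neq_one)
  then obtain y1 y2 where y: "y = y1 @ 0 # y2" and y1: "0 \<notin> set y1"
    by (metis split_list_first)
  have y2: "0 \<notin> set y2"
    using assms(3) by (auto simp: y dias_words_def count_list_0_iff)
  have ymin_in: "dias_min y \<in> set y - {0}"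
    unfolding dias_min_def
  proof (rule Min_in)
    have "length y \<ge> 2" using assms by (simp add: dias_words_def)
    then have "y1 \<noteq> [] \<or> y2 \<noteq> []" by (auto simp: y)
    then show "set y - {0} \<noteq> {}"
      using y1 y2 by (cases y1; cases y2) (auto simp: y)
  qed simp
  have ymin_le: "dias_min y \<le> c" if "c \<in> set y" "c \<noteq> 0" for c
    unfolding dias_min_def using that by (intro Min_le) auto
  let ?K = "K_letter \<gamma> :: nat \<Rightarrow> (nat \<Rightarrow>\<^sub>0 'k)" and ?E = "letter \<gamma> :: nat \<Rightarrow> (nat \<Rightarrow>\<^sub>0 'k)"
  \<comment> \<open>\<open>L\<close> and \<open>R\<close> collect the factors on either side of the
    slot coming from the zero of \<open>y\<close>.\<close>
  define L where "L = map ?K (pre @ y1)"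
  define R where "R = map ?K (y2 @ post)"
  \<comment> \<open>Needed for \<open>q = p\<close> and \<open>q = Suc p\<close>. If
    \<open>q\<close> is at most the minimum, all nonzero letters of \<open>y\<close> are fixed;
    otherwise the smallest one yields a zero factor.\<close>
  have comp_letter: "dias_comp i (tens (map ?K pre @ ?E q # map ?K post)) (tens (map ?K y)) =
      (if q \<le> dias_min y then tens (L @ ?E q # R) else 0)" for q
  proof -
    have *: "dias_comp i (tens (map ?K pre @ ?E q # map ?K post)) (tens (map ?K y)) =
        tens (map ?K pre @ map (bilin max (?E q)) (map ?K y) @ map ?K post)"
      using dias_comp_tens_letter[of "map ?K y" "map ?K pre" \<gamma> q "map ?K post"] i(3)
      by (simp add: y)
    show ?thesis
    proof (cases "q \<le> dias_min y")
      case True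
      then have "bilin max (?E q) (?K c) = ?K c" if "c \<in> set y1 \<union> set y2" for c
        using that y1 y2 ymin_le[of c] by (auto simp: bilin_max_K_letter y)
      then have "map (bilin max (?E q)) (map ?K y) = map ?K y1 @ ?E q # map ?K y2"
        by (simp add: y bilin_max_K_letter)
      with * True show ?thesis by (simp add: L_def R_def)
    next
      case False
      then have "bilin max (?E q) (?K (dias_min y)) = 0"
        using ymin_in by (simp add: bilin_max_K_letter)
      then have "0 \<in> set (map (bilin max (?E q)) (map ?K y))"
        using ymin_in by force
      with * False show ?thesis by (auto intro!: tens_eq_0)
    qed
  qed
  have word_comp: "word_comp i x y = pre @ y1 @ p # y2 @ post" if p_min: "p \<le> dias_min y"
  proof -
    have "max p c = c" if "c \<in> set y1 \<union> set y2" for c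
    proof -
      have "c \<in> set y" "c \<noteq> 0" using that y1 y2 by (cases "c = 0"; auto simp: y)+
      with ymin_le[of c] p_min show ?thesis by simp
    qed
    then have "map (max p) y = y1 @ p # y2"
      by (simp add: y map_idI)
    then show ?thesis
      unfolding word_comp_def by (fold p_def pre_def post_def) simp
  qed
  \<comment> \<open>The side condition keeps exactly one zero: if \<open>p\<close> is nonzero, the
    zero of \<open>x\<close> lies in \<open>pre\<close> or \<open>post\<close>; if
    \<open>p = 0\<close>, it is the slot itself.\<close>
  have K_word: "dias_K \<gamma> (pre @ y1 @ a # y2 @ post) = tens (L @ ?K a # R)"
    if "a \<le> \<gamma>" "a = 0 \<longleftrightarrow> p = 0" for a
  proof -
    have "pre @ y1 @ a # y2 @ post \<in> dias_words \<gamma> (length (pre @ y1 @ a # y2 @ post))"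
      using assms(1,3) that y1 y2 by (auto simp: x y dias_words_def split: if_splits)
    from dias_K_eq_tens[OF this] show ?thesis by (simp add: L_def R_def)
  qed
  have K_xy: "dias_K \<gamma> x = tens (map ?K pre @ ?K p # map ?K post)" "dias_K \<gamma> y = tens (map ?K y)"
    using dias_K_eq_tens[OF assms(1)] dias_K_eq_tens[OF assms(3)] by (simp_all add: x)
  show ?thesis
  proof (cases "p = 0")
    case True
    then have "?K p = ?E p" "p < dias_min y"
      using ymin_in by (auto simp: K_letter_def)
    then show ?thesis
      using comp_letter[of p] word_comp K_word[of p] p_le by (fold p_def) (simp add: K_xy)
  next
    case False
    then have Kp: "?K p = ?E p - ?E (Suc p)" by (simp add: K_letter_def)
    have comp: "dias_comp i (dias_K \<gamma> x) (dias_K \<gamma> y) =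
        (if p \<le> dias_min y then tens (L @ ?E p # R) else 0) -
        (if Suc p \<le> dias_min y then tens (L @ ?E (Suc p) # R) else 0)"
      unfolding K_xy Kp tens_diff comp_letter[symmetric] dias_comp_eq_bilin bilin_diff_left ..
    consider "p < dias_min y" | "p = dias_min y" | "dias_min y < p" by linarith
    then show ?thesis
    proof cases
      case 1
      then show ?thesis
        using comp word_comp K_word[of p] p_le by (fold p_def) (simp add: Kp tens_diff)
    next
      case 2
      \<comment> \<open>The updated index is thus the length of \<open>pre @ y1\<close>, the slot of
        the zero of \<open>y\<close>.\<close>
      have "takeWhile (\<lambda>b. b \<noteq> 0) y = y1"
        using y1 by (auto simp: y takeWhile_append)
      then have at: "word_comp_at a i x y = pre @ y1 @ a # y2 @ post" for a
        using 2 word_comp i(3) by (simp add: word_comp_at_def list_update_append)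
      have "tens (L @ ?E p # R) = (\<Sum>a\<in>{p..\<gamma>}. tens (L @ ?K a # R))"
        using False p_le by (simp add: letter_eq_sum_K_letter tens_sum)
      \<comment> \<open>Every \<open>a\<close> in the range is nonzero like \<open>p\<close>, so
        \<open>K_word\<close> applies.\<close>
      also have "\<dots> = (\<Sum>a\<in>{p..\<gamma>}. dias_K \<gamma> (word_comp_at a i x y))"
        using False by (intro sum.cong refl) (simp add: at K_word)
      finally show ?thesis
        using comp 2 by (fold p_def) simp
    next
      case 3
      then show ?thesis using comp by (fold p_def) simp
    qed
  qed
qed

end
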